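(* Assume $\mathfrak p=\mathfrak c$. Then there exists a completely separable pseudocompact MAD family on $\omega$ that is not fin-intersecting.
   Context: An almost disjoint family on $\omega$ is an infinite set $\mathcal A$ of infinite subsets of $\omega$ such that $a\cap b$ is finite for all distinct $a,b\in\mathcal A$; it is MAD if it is not properly contained in any other almost disjoint family on $\omega$. $\mathcal I(\mathcal A)=\{X\subseteq\omega: \exists \mathcal B\in[\mathcal A]^{<\omega}\ X\subseteq^*\bigcup\mathcal B\}$, where $X\subseteq^*Y$ means $X\setminus Y$ is finite, and $\mathcal I^+(\mathcal A)=\mathcal P(\omega)\setminus\mathcal I(\mathcal A)$. A MAD family $\mathcal A$ is completely separable if for every $X\in\mathcal I^+(\mathcal A)$ there is $a\in\mathcal A$ with $a\subseteq X$. A fin sequence is a function $C:\omega\to[\omega]^{<\omega}\setminus\{\emptyset\}$ with $C(n)\cap C(m)=\emptyset$ whenever $n\neq m$. A collection of sets is centered if every finite nonempty subcollection has infinite intersection. An almost disjoint family $\mathcal A$ is fin-intersecting if for every fin sequence $C$ there exists an infinite $I\subseteq\omega$ such that $\{\{n\in I: a\cap C(n)\neq\emptyset\}: a\in\mathcal A\}\setminus[I]^{<\omega}$ is centered, where $[I]^{<\omega}$ is the set of finite subsets of $I$. The space $\Psi(\mathcal A)$ is the set $\omega\cup\mathcal A$ (a disjoint union) with the topology having as a basis $\{\{n\}:n\in\omega\}\cup\{\{a\}\cup(a\setminus F): a\in\mathcal A,\ F\in[\omega]^{<\omega}\}$. For a $T_1$ space $X$, $\exp(X)$ is the set of nonempty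 closed subsets of $X$ with the Vietoris topology, i.e. the topology generated by all sets $U^+=\{F\in\exp(X): F\subseteq U\}$ and $U^-=\{F\in\exp(X): F\cap U\neq\emptyset\}$ for $U\subseteq X$ open. A topological space is pseudocompact if every continuous real-valued function on it is bounded. An almost disjoint family $\mathcal A$ is called pseudocompact if $\exp(\Psi(\mathcal A))$ is pseudocompact. $\mathfrak c=2^{\aleph_0}$. $\mathfrak p$ is the least cardinality of a centered collection $\mathcal P$ of infinite subsets of $\omega$ for which there is no infinite $P\subseteq\omega$ with $P\subseteq^* A$ for every $A\in\mathcal P$. *)

theory Defs
  imports "HOL-Analysis.Analysis"
begin

unbundle cardinal_syntax

section \<open>Almost disjoint families\<close>

definition almost_subset :: "nat set \<Rightarrow> nat set \<Rightarrow> bool" (infix "\<subseteq>\<^sup>*" 50) where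
  "X \<subseteq>\<^sup>* Y \<longleftrightarrow> finite (X - Y)"

definition almost_disjoint_family :: "nat set set \<Rightarrow> bool" where
  "almost_disjoint_family \<A> \<longleftrightarrow>
     infinite \<A> \<and> (\<forall>a\<in>\<A>. infinite a) \<and> (\<forall>a\<in>\<A>. \<forall>b\<in>\<A>. a \<noteq> b \<longrightarrow> finite (a \<inter> b))"

definition mad_family :: "nat set set \<Rightarrow> bool" where
  "mad_family \<A> \<longleftrightarrow>
     almost_disjoint_family \<A> \<and> \<not> (\<exists>\<B>. almost_disjoint_family \<B> \<and> \<A> \<subset> \<B>)"

definition ad_ideal :: "nat set set \<Rightarrow> nat set set" where
  "ad_ideal \<A> = {X. \<exists>\<B>. finite \<B> \<and> \<B> \<subseteq> \<A> \<and> X \<subseteq>\<^sup>* \<Union>\<B>}"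

definition ad_positive :: "nat set set \<Rightarrow> nat set set" where
  "ad_positive \<A> = UNIV - ad_ideal \<A>"

definition completely_separable :: "nat set set \<Rightarrow> bool" where
  "completely_separable \<A> \<longleftrightarrow> mad_family \<A> \<and> (\<forall>X\<in>ad_positive \<A>. \<exists>a\<in>\<A>. a \<subseteq> X)"

section \<open>Fin-intersecting families\<close>

definition centered :: "'a set set \<Rightarrow> bool" where
  "centered \<P> \<longleftrightarrow> (\<forall>\<F>. finite \<F> \<and> \<F> \<noteq> {} \<and> \<F> \<subseteq> \<P> \<longrightarrow> infinite (\<Inter>\<F>))"

definition fin_sequence :: "(nat \<Rightarrow> nat set) \<Rightarrow> bool" where
  "fin_sequence C \<longleftrightarrow>
     (\<forall>n. finite (C n) \<and> C n \<noteq> {}) \<and> (\<forall>n m. n \<noteq> m \<longrightarrow> C n \<inter> C m = {})"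

definition fin_intersecting :: "nat set set \<Rightarrow> bool" where
  "fin_intersecting \<A> \<longleftrightarrow>
     (\<forall>C. fin_sequence C \<longrightarrow>
        (\<exists>I. infinite I \<and>
             centered ((\<lambda>a. {n \<in> I. a \<inter> C n \<noteq> {}}) ` \<A> - {J. J \<subseteq> I \<and> finite J})))"

section \<open>The space \<open>\<Psi>(\<A>)\<close>, hyperspaces and pseudocompactness\<close>

text \<open>The disjoint union of \<open>\<omega>\<close> and \<open>\<A>\<close> is realised inside \<^typ>\<open>nat + nat set\<close>:
  \<open>n\<close> is \<open>Inl n\<close> and the point \<open>a \<in> \<A>\<close> is \<open>Inr a\<close>.\<close>

definition Psi_basis :: "nat set set \<Rightarrow> (nat + nat set) set set" where
  "Psi_basis \<A> =
     {{Inl n} |n. True} \<union> {insert (Inr a) (Inl ` (a - F)) |a F. a \<in> \<A> \<and> finite F}"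

definition Psi_space :: "nat set set \<Rightarrow> (nat + nat set) topology" where
  "Psi_space \<A> = topology_generated_by (Psi_basis \<A>)"

definition vietoris :: "'a topology \<Rightarrow> 'a set topology" where
  "vietoris X = topology_generated_by
     ((\<lambda>U. {F. closedin X F \<and> F \<noteq> {} \<and> F \<subseteq> U}) ` {U. openin X U} \<union>
      (\<lambda>U. {F. closedin X F \<and> F \<noteq> {} \<and> F \<inter> U \<noteq> {}}) ` {U. openin X U})"

definition pseudocompact_space :: "'a topology \<Rightarrow> bool" where
  "pseudocompact_space X \<longleftrightarrow>
     (\<forall>f. continuous_map X euclideanreal f \<longrightarrow> bounded (f ` topspace X))"

definition pseudocompact_family :: "nat set set \<Rightarrow> bool" where
  "pseudocompact_family \<A> \<longleftrightarrow> pseudocompact_space (vietoris (Psi_space \<A>))"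

lemma topspace_Psi_space: "topspace (Psi_space \<A>) = range Inl \<union> Inr ` \<A>"
  unfolding Psi_space_def topology_generated_by_topspace Psi_basis_def by blast

lemma openin_Psi_space:
  "openin (Psi_space \<A>) U \<longleftrightarrow> (\<exists>\<B>\<subseteq>Psi_basis \<A>. U = \<Union>\<B>)"
proof
  assume "openin (Psi_space \<A>) U"
  then have "generate_topology_on (Psi_basis \<A>) U"
    by (simp add: Psi_space_def openin_topology_generated_by)
  then have *: "\<forall>x\<in>U. \<exists>B\<in>Psi_basis \<A>. x \<in> B \<and> B \<subseteq> U"
  proof induction
    case Empty
    show ?case by simp
  next
    case (UN K)
    show ?case
    proof
      fix x assume "x \<in> \<Union>K"
      then obtain V where "V \<in> K" "x \<in> V" by blast
      then show "\<exists>B\<in>Psi_basis \<A>. x \<in> B \<and> B \<subseteq> \<Union>K"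
        using UN.IH[of V] by (meson Union_upper subset_trans)
    qed
  next
    case (Basis B)
    then show ?case by blast
  next
    case (Int U V)
    show ?case
    proof
      fix x assume x: "x \<in> U \<inter> V"
      then obtain B C where B: "B \<in> Psi_basis \<A>" "x \<in> B" "B \<subseteq> U"
        and C: "C \<in> Psi_basis \<A>" "x \<in> C" "C \<subseteq> V"
        using Int.IH(1)[rule_format, of x] Int.IH(2)[rule_format, of x] by auto
      show "\<exists>B\<in>Psi_basis \<A>. x \<in> B \<and> B \<subseteq> U \<inter> V"
      proof (cases x)
        case (Inl n)
        show ?thesis
          by (rule bexI[of _ "{Inl n}"]) (use Inl x in \<open>auto simp: Psi_basis_def\<close>)
      next
        case (Inr a)
        obtain F where F: "B = insert (Inr a) (Inl ` (a - F))" "a \<in> \<A>" "finite F"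
          using B Inr by (auto simp: Psi_basis_def)
        obtain G where G: "C = insert (Inr a) (Inl ` (a - G))" "finite G"
          using C Inr by (auto simp: Psi_basis_def)
        have "insert (Inr a) (Inl ` (a - (F \<union> G))) \<in> Psi_basis \<A>"
          unfolding Psi_basis_def
          by (rule UnI2, rule CollectI, rule exI[of _ a], rule exI[of _ "F \<union> G"])
            (simp add: F(2,3) G(2))
        moreover have "insert (Inr a) (Inl ` (a - (F \<union> G))) \<subseteq> U \<inter> V"
          using B(3) C(3) unfolding F(1) G(1) by auto
        ultimately show ?thesis using Inr by (intro bexI conjI) auto
      qed
    qed
  qed
  show "\<exists>\<B>\<subseteq>Psi_basis \<A>. U = \<Union>\<B>"
  proof (intro exI conjI)
    show "{B \<in> Psi_basis \<A>. B \<subseteq> U} \<subseteq> Psi_basis \<A>" by simp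
    show "U = \<Union>{B \<in> Psi_basis \<A>. B \<subseteq> U}" using * by blast
  qed
next
  assume "\<exists>\<B>\<subseteq>Psi_basis \<A>. U = \<Union>\<B>"
  then obtain \<B> where \<B>: "\<B> \<subseteq> Psi_basis \<A>" "U = \<Union>\<B>" by blast
  have "openin (Psi_space \<A>) B" if "B \<in> \<B>" for B
    unfolding Psi_space_def
    by (rule topology_generated_by_Basis) (rule subsetD[OF \<B>(1) that])
  then show "openin (Psi_space \<A>) U"
    unfolding \<B>(2) by (rule openin_Union)
qed

lemma topspace_vietoris: "topspace (vietoris X) = {F. closedin X F \<and> F \<noteq> {}}"
  unfolding vietoris_def topology_generated_by_topspace
  using closedin_subset[of X] openin_topspace[of X] by blast

section \<open>The cardinals \<open>\<cc>\<close> and \<open>\<pp>\<close>\<close>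

text \<open>Cardinals are represented, as in the library, by cardinal well-orders up to \<open>=o\<close>;
  \<^const>\<open>natLeq\<close> represents \<open>\<aleph>\<^sub>0\<close>.\<close>

definition continuum :: "(nat \<Rightarrow> bool) rel" where
  "continuum = ctwo ^c natLeq"

definition no_pseudointersection :: "nat set set \<Rightarrow> bool" where
  "no_pseudointersection \<P> \<longleftrightarrow>
     centered \<P> \<and> (\<forall>A\<in>\<P>. infinite A) \<and> \<not> (\<exists>P. infinite P \<and> (\<forall>A\<in>\<P>. P \<subseteq>\<^sup>* A))"

definition pseudointersection_number :: "nat set rel" where
  "pseudointersection_number =
     |SOME \<P>. no_pseudointersection \<P> \<and> (\<forall>\<Q>. no_pseudointersection \<Q> \<longrightarrow> |\<P>| \<le>o |\<Q>| )|"

lemma continuum_ordIso_card_of: "continuum =o |UNIV :: nat set set|"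
proof -
  have "|Pow (UNIV :: nat set)| =o continuum"
    unfolding continuum_def ctwo_def cexp_def Field_card_of Field_natLeq
    by (rule card_of_Pow_Func)
  then show ?thesis by (simp add: ordIso_symmetric)
qed

lemma no_pseudointersection_exists: "\<exists>\<P>. no_pseudointersection \<P>"
proof -
  have "\<exists>M\<in>Collect centered. \<forall>X\<in>Collect centered. M \<subseteq> X \<longrightarrow> X = (M :: nat set set)"
  proof (rule subset_Zorn', goal_cases)
    case (1 K)
    have "centered (\<Union>K)"
      unfolding centered_def
    proof (intro allI impI)
      fix \<F> assume \<F>: "finite \<F> \<and> \<F> \<noteq> {} \<and> \<F> \<subseteq> \<Union>K"
      then have "K \<noteq> {}" by blast
      then obtain P where "P \<in> K" "\<F> \<subseteq> P"
        using finite_subset_Union_chain[of \<F> K "Collect centered"] \<F> 1 by blast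
      moreover have "centered P" using 1 \<open>P \<in> K\<close> by (auto simp: subset_chain_def)
      ultimately show "infinite (\<Inter>\<F>)" using \<F> by (simp add: centered_def)
    qed
    then show ?case by simp
  qed
  then obtain M :: "nat set set" where M: "centered M"
    and max: "\<And>X. centered X \<Longrightarrow> M \<subseteq> X \<Longrightarrow> X = M"
    by blast
  have inf: "infinite A" if "A \<in> M" for A
    using M[unfolded centered_def, rule_format, of "{A}"] that by simp
  have False if P: "infinite P" "\<forall>A\<in>M. P \<subseteq>\<^sup>* A" for P
  proof -
    obtain Q R where "Q \<subseteq> P" "R \<subseteq> P" "infinite Q" "infinite R" "Q \<inter> R = {}"
      using infinite_split[OF P(1)] by blast
    then have Q: "Q \<subseteq> P" "infinite Q" "infinite (P - Q)"
      by (auto dest: finite_subset[of R "P - Q", rotated])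
    have "centered (insert Q M)"
      unfolding centered_def
    proof (intro allI impI)
      fix \<F> assume \<F>: "finite \<F> \<and> \<F> \<noteq> {} \<and> \<F> \<subseteq> insert Q M"
      have "Q - \<Inter>\<F> \<subseteq> (\<Union>A\<in>\<F> - {Q}. P - A)" using Q by blast
      moreover have "finite (\<Union>A\<in>\<F> - {Q}. P - A)"
        using \<F> P(2) by (intro finite_UN_I) (auto simp: almost_subset_def)
      ultimately have "finite (Q - \<Inter>\<F>)" by (rule finite_subset)
      then show "infinite (\<Inter>\<F>)" using Q(2)
        by (auto dest: Diff_infinite_finite)
    qed
    then have "Q \<in> M" using max by blast
    then show False using P(2) Q(3) by (auto simp: almost_subset_def)
  qed
  then show ?thesis using M inf unfolding no_pseudointersection_def by blast
qed

lemma pseudointersection_number_least: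
  shows "\<exists>\<P>. no_pseudointersection \<P> \<and> pseudointersection_number = |\<P>|"
    and "no_pseudointersection \<Q> \<Longrightarrow> pseudointersection_number \<le>o |\<Q>|"
proof -
  let ?least = "\<lambda>\<P>. no_pseudointersection \<P> \<and> (\<forall>\<Q>. no_pseudointersection \<Q> \<longrightarrow> |\<P>| \<le>o |\<Q>| )"
  have "\<exists>r\<in>card_of ` Collect no_pseudointersection.
          \<forall>r'\<in>card_of ` Collect no_pseudointersection. r \<le>o r'"
    using no_pseudointersection_exists
    by (intro exists_minim_Card_order) (auto intro: card_of_Card_order)
  then have "\<exists>\<P>. ?least \<P>" by auto
  then have "?least (SOME \<P>. ?least \<P>)" by (rule someI_ex)
  then show "\<exists>\<P>. no_pseudointersection \<P> \<and> pseudointersection_number = |\<P>|"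
    and "no_pseudointersection \<Q> \<Longrightarrow> pseudointersection_number \<le>o |\<Q>|"
    unfolding pseudointersection_number_def by blast+
qed

end

theory Submission
  imports Defs
begin

text \<open>
  Under \<open>\<pp> = \<cc>\<close> fewer than \<open>\<cc>\<close> sets with the strong finite intersection property always have an
  infinite pseudointersection, so recursions of length \<open>\<cc>\<close> never get stuck. Two of them are used.

  \<^emph>\<open>Every MAD family \<open>\<A>\<close> is pseudocompact.\<close> The finite nonempty subsets of \<open>\<omega>\<close> are dense in
  \<open>exp(\<Psi>(\<A>))\<close>, so it suffices that every sequence \<open>F\<close> of such sets accumulates. If \<open>s\<close> is any
  sequence of natural numbers, then every infinite set of indices has an infinite subset along
  which \<open>s\<close> is constant or runs injectively inside one \<open>a \<in> \<A>\<close>, by maximality; either way \<open>s\<close>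
  converges along it in \<open>\<Psi>(\<A>)\<close>. There are only \<open>\<cc>\<close> such sequences, so one filter on the indices
  makes all of them converge at once (\<open>selector_tower\<close>). The set of points whose neighbourhoods
  meet \<open>F k\<close> for filter-many \<open>k\<close> is then a limit of \<open>F\<close>: if an open \<open>U\<close> contains this set, take
  a sequence choosing from each \<open>F k\<close> a point outside \<open>U\<close> where there is one; its limit is in
  \<open>U\<close>, hence for filter-many \<open>k\<close> there was none (\<open>finite_sets_accumulate\<close>).

  \<^emph>\<open>A completely separable MAD family that is not fin-intersecting.\<close> Fix a fin sequence \<open>C\<close> with
  \<open>|C n|\<close> tending to infinity. The usual recursion, which handles each \<open>X \<subseteq> \<omega>\<close> in turn and puts
  a subset of \<open>X\<close> into the family as long as \<open>X\<close> is still positive, can be run with sets that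
  meet each \<open>C n\<close> in at most one point (\<open>completely_separable_selectors\<close>). Finitely many such
  sets cannot almost cover \<open>\<Union>(C ` I)\<close> for an infinite \<open>I\<close>, so all these unions are positive.
  Split a given \<open>I\<close> into two infinite pieces; complete separability yields members of the family
  inside \<open>\<Union>(C ` J)\<close> for each of the two pieces \<open>J\<close>, and the sets of indices that they hit are
  infinite and disjoint (\<open>not_fin_intersecting\<close>).
\<close>

section \<open>Recursions of length continuum\<close>

lemma pseudointersection_exists:
  assumes "pseudointersection_number =o continuum"
    and "centered \<P>" and "|\<P>| <o continuum"
  shows "\<exists>P. infinite P \<and> (\<forall>A\<in>\<P>. P \<subseteq>\<^sup>* A)"
proof (rule ccontr)
  assume "\<not> ?thesis"
  moreover have "infinite A" if "A \<in> \<P>" for A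
    using assms(2)[unfolded centered_def, rule_format, of "{A}"] that by simp
  ultimately have "no_pseudointersection \<P>"
    using assms(2) by (auto simp: no_pseudointersection_def)
  then have "pseudointersection_number \<le>o |\<P>|"
    by (rule pseudointersection_number_least(2))
  then have "continuum \<le>o |\<P>|"
    using assms(1) ordIso_ordLeq_trans ordIso_symmetric by blast
  then show False
    using assms(3) not_ordLess_ordLeq by blast
qed

lemma initial_segment_less_continuum:
  assumes "|UNIV :: 'i set| \<le>o continuum"
  shows "|T ` underS |UNIV :: 'i set| i| <o continuum"
proof -
  have "|underS |UNIV :: 'i set| i| <o |UNIV :: 'i set|"
    by (rule card_of_underS[OF card_of_Card_order]) (simp add: Field_card_of)
  then show ?thesis
    using assms card_of_image ordLeq_ordLess_trans ordLess_ordLeq_trans by blast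
qed

lemma wf_card_of: "wf ( |A| - Id)"
  using card_of_Well_order well_order_on_def by blast

lemma almost_subset_trans: "X \<subseteq>\<^sup>* Y \<Longrightarrow> Y \<subseteq>\<^sup>* Z \<Longrightarrow> X \<subseteq>\<^sup>* Z"
  unfolding almost_subset_def by (rule finite_subset[of _ "(X - Y) \<union> (Y - Z)"]) auto

text \<open>Of finitely many members of a decreasing chain, the one that comes last is almost contained
  in all the others.\<close>

lemma centered_decreasing:
  assumes r: "Well_order r" and S: "S \<subseteq> Field r"
    and inf: "\<And>i. i \<in> S \<Longrightarrow> infinite (T i)"
    and dec: "\<And>i j. i \<in> S \<Longrightarrow> j \<in> S \<Longrightarrow> (i, j) \<in> r - Id \<Longrightarrow> T j \<subseteq>\<^sup>* T i"
  shows "centered (T ` S)"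
  unfolding centered_def
proof (intro allI impI)
  fix \<F> assume \<F>: "finite \<F> \<and> \<F> \<noteq> {} \<and> \<F> \<subseteq> T ` S"
  then obtain J where J: "finite J" "J \<subseteq> S" "\<F> = T ` J"
    by (meson finite_subset_image)
  have "J \<noteq> {}" using \<F> J(3) by blast
  have tot: "(i, j) \<in> r - Id \<or> i = j \<or> (j, i) \<in> r - Id" if "i \<in> S" "j \<in> S" for i j
    using r S that unfolding well_order_on_def linear_order_on_def total_on_def by blast
  from J(1) \<open>J \<noteq> {}\<close> J(2) have "\<exists>m\<in>J. \<forall>i\<in>J. T m \<subseteq>\<^sup>* T i"
  proof (induction rule: finite_ne_induct)
    case (singleton i)
    then show ?case by (simp add: almost_subset_def)
  next
    case (insert i J)
    then obtain m where m: "m \<in> J" "\<forall>j\<in>J. T m \<subseteq>\<^sup>* T j" by auto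
    have refl: "T i \<subseteq>\<^sup>* T i" by (simp add: almost_subset_def)
    from tot[of m i] insert.prems m(1) consider "T i \<subseteq>\<^sup>* T m" | "T m \<subseteq>\<^sup>* T i"
      using dec refl by blast
    then show ?case
    proof cases
      case 1
      then have "\<forall>j\<in>insert i J. T i \<subseteq>\<^sup>* T j"
        using m(2) refl almost_subset_trans by blast
      then show ?thesis by blast
    next
      case 2
      then show ?thesis using m by blast
    qed
  qed
  then obtain m where m: "m \<in> J" "\<forall>i\<in>J. T m \<subseteq>\<^sup>* T i" by blast
  have "T m - \<Inter>\<F> = (\<Union>i\<in>J. T m - T i)" using J(3) by blast
  moreover have "finite (\<Union>i\<in>J. T m - T i)"
    using m(2) J(1) by (intro finite_UN_I) (auto simp: almost_subset_def)
  ultimately show "infinite (\<Inter>\<F>)"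
    using inf[of m] m(1) J(2) by (metis Diff_infinite_finite subsetD)
qed

text \<open>A generic filter for \<open>\<cc>\<close> many dense sets: the members picked so far form a decreasing chain,
  a pseudointersection continues it, and density lets the next member be chosen below that.\<close>

lemma centered_meeting_dense:
  fixes D :: "'i \<Rightarrow> nat set set"
  assumes pc: "pseudointersection_number =o continuum"
    and card: "|UNIV :: 'i set| \<le>o continuum"
    and dense: "\<And>i X. infinite X \<Longrightarrow> \<exists>Y\<in>D i. infinite Y \<and> Y \<subseteq> X"
  shows "\<exists>T. (\<forall>i. T i \<in> D i) \<and> centered (range T)"
proof -
  let ?r = "|UNIV :: 'i set|"
  let ?P = "\<lambda>T i Y. Y \<in> D i \<and> infinite Y \<and> (\<forall>j\<in>underS ?r i. Y \<subseteq>\<^sup>* T j)"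
  have r: "Well_order ?r" by (rule card_of_Well_order)
  have "\<exists>T. \<forall>i. ?P T i (T i)"
  proof (rule dependent_wf_choice[OF wf_card_of[of UNIV]], goal_cases)
    case (1 f g i Y)
    then show ?case by (auto simp: underS_def)
  next
    case (2 i T)
    have below: "?P T j (T j)" if "j \<in> underS ?r i" for j
      using 2[of j] that by (auto simp: underS_def)
    have "centered (T ` underS ?r i)"
      by (rule centered_decreasing[OF r]) (use below in \<open>auto simp: underS_def Field_card_of\<close>)
    then obtain P where P: "infinite P" "\<And>j. j \<in> underS ?r i \<Longrightarrow> P \<subseteq>\<^sup>* T j"
      using pseudointersection_exists[OF pc _ initial_segment_less_continuum[OF card]] by blast
    obtain Y where "Y \<in> D i" "infinite Y" "Y \<subseteq> P" using dense[OF P(1)] by blast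
    moreover have "Y \<subseteq>\<^sup>* T j" if "j \<in> underS ?r i" for j
      using P(2)[OF that] \<open>Y \<subseteq> P\<close> unfolding almost_subset_def
      by (meson Diff_mono finite_subset order_refl)
    ultimately show ?case by blast
  qed
  then obtain T where T: "\<And>i. ?P T i (T i)" by blast
  have "centered (range T)"
    by (rule centered_decreasing[OF r]) (use T in \<open>auto simp: underS_def Field_card_of\<close>)
  then show ?thesis using T by blast
qed

section \<open>Maximal almost disjoint families are pseudocompact\<close>

lemma mad_family_meets:
  assumes "mad_family \<A>" and "infinite X"
  shows "\<exists>a\<in>\<A>. infinite (a \<inter> X)"
proof (rule ccontr)
  assume *: "\<not> ?thesis"
  then have "X \<notin> \<A>" using assms(2) by force
  have "almost_disjoint_family (insert X \<A>)"
    using assms * unfolding mad_family_def almost_disjoint_family_def by (auto simp: Int_commute)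
  then show False
    using assms(1) \<open>X \<notin> \<A>\<close> unfolding mad_family_def by blast
qed

lemma infinite_image_inj_subset:
  assumes "infinite (f ` X)"
  shows "\<exists>Y\<subseteq>X. infinite Y \<and> inj_on f Y"
proof -
  obtain Y where "Y \<subseteq> X" "f ` X = f ` Y" "inj_on f Y"
    by (meson subset_image_inj subset_refl)
  then show ?thesis using assms finite_imageI by metis
qed

lemma card_of_sequences_le_continuum: "|UNIV :: (nat \<Rightarrow> nat) set| \<le>o continuum"
proof -
  have "inj (\<lambda>s::nat \<Rightarrow> nat. {prod_encode (k, s k) |k. True})"
  proof (rule injI, rule ext)
    fix s t :: "nat \<Rightarrow> nat" and k
    assume "{prod_encode (k, s k) |k. True} = {prod_encode (k, t k) |k. True}"
    then have "prod_encode (k, s k) \<in> {prod_encode (k, t k) |k. True}" by blast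
    then show "s k = t k" by (auto simp: prod_encode_eq)
  qed
  then have "|UNIV :: (nat \<Rightarrow> nat) set| \<le>o |UNIV :: nat set set|"
    by (rule card_of_ordLeq[THEN iffD1, OF exI, OF conjI]) simp
  then show ?thesis
    using continuum_ordIso_card_of ordIso_symmetric ordLeq_ordIso_trans by blast
qed

text \<open>The dense sets are indexed by the sequences \<open>s\<close> themselves, and density is a dichotomy: on an
  infinite set of indices \<open>s\<close> either takes some value infinitely often, or has an infinite range
  there, which some \<open>a \<in> \<A>\<close> meets in an infinite set by maximality.\<close>

lemma selector_tower:
  assumes "pseudointersection_number =o continuum" and mad: "mad_family \<A>"
  shows "\<exists>T :: (nat \<Rightarrow> nat) \<Rightarrow> nat set. centered (range T) \<and>
    (\<forall>s. (\<exists>n. \<forall>k\<in>T s. s k = n) \<or> (inj_on s (T s) \<and> (\<exists>a\<in>\<A>. s ` T s \<subseteq> a)))"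
proof -
  let ?D = "\<lambda>s :: nat \<Rightarrow> nat. {Y. (\<exists>n. \<forall>k\<in>Y. s k = n) \<or> (inj_on s Y \<and> (\<exists>a\<in>\<A>. s ` Y \<subseteq> a))}"
  have dense: "\<exists>Y\<in>?D s. infinite Y \<and> Y \<subseteq> X" if X: "infinite X" for s :: "nat \<Rightarrow> nat" and X :: "nat set"
  proof (cases "finite (s ` X)")
    case True
    then obtain n where "infinite {k \<in> X. s k = n}"
      using pigeonhole_infinite[OF X True] by auto
    then show ?thesis by (intro bexI[of _ "{k \<in> X. s k = n}"]) auto
  next
    case False
    then obtain a where a: "a \<in> \<A>" "infinite (a \<inter> s ` X)"
      using mad_family_meets[OF mad] by blast
    have "s ` {k \<in> X. s k \<in> a} = a \<inter> s ` X" by auto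
    then obtain Y where "Y \<subseteq> {k \<in> X. s k \<in> a}" "infinite Y" "inj_on s Y"
      using infinite_image_inj_subset[of s "{k \<in> X. s k \<in> a}"] a(2) by auto
    then show ?thesis using a(1) by (intro bexI[of _ Y]) auto
  qed
  have "\<exists>T. (\<forall>s. T s \<in> ?D s) \<and> centered (range T)"
    by (rule centered_meeting_dense[OF assms(1) card_of_sequences_le_continuum]) (rule dense)
  then show ?thesis by auto
qed

lemma Psi_open_almost_contains:
  assumes "openin (Psi_space \<A>) V" and "Inr a \<in> V"
  shows "finite {n \<in> a. Inl n \<notin> V}"
proof -
  obtain B where "B \<in> Psi_basis \<A>" "Inr a \<in> B" "B \<subseteq> V"
    using assms unfolding openin_Psi_space by blast
  then obtain F where "finite F" "insert (Inr a) (Inl ` (a - F)) \<subseteq> V"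
    by (auto simp: Psi_basis_def)
  then show ?thesis by (auto elim!: finite_subset[rotated])
qed

lemma Psi_open_meets_naturals:
  assumes \<A>: "\<forall>a\<in>\<A>. infinite a" and V: "openin (Psi_space \<A>) V" "V \<noteq> {}"
  shows "\<exists>n. Inl n \<in> V"
proof -
  obtain x where x: "x \<in> V" using V(2) by blast
  show ?thesis
  proof (cases x)
    case (Inr a)
    then have "a \<in> \<A>" using x openin_subset[OF V(1)] by (auto simp: topspace_Psi_space)
    then have "infinite a" using \<A> by blast
    then have "{n \<in> a. Inl n \<notin> V} \<noteq> a"
      using Psi_open_almost_contains[OF V(1), of a] x Inr by auto
    then show ?thesis by blast
  qed (use x in auto)
qed

lemma closedin_Psi_finite:
  assumes "finite F"
  shows "closedin (Psi_space \<A>) (Inl ` F)"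
proof -
  let ?\<B> = "{B \<in> Psi_basis \<A>. B \<inter> Inl ` F = {}}"
  have "x \<in> \<Union>?\<B>" if x: "x \<in> topspace (Psi_space \<A>)" "x \<notin> Inl ` F" for x
  proof (cases x)
    case (Inl n)
    then show ?thesis using x by (auto simp: Psi_basis_def)
  next
    case (Inr a)
    then have "insert (Inr a) (Inl ` (a - F)) \<in> ?\<B>"
      using x assms by (auto simp: topspace_Psi_space Psi_basis_def)
    then show ?thesis using Inr by blast
  qed
  moreover have "\<Union>?\<B> \<subseteq> topspace (Psi_space \<A>)"
    unfolding Psi_space_def topology_generated_by_topspace by blast
  ultimately have "topspace (Psi_space \<A>) - Inl ` F = \<Union>?\<B>" by blast
  then have "openin (Psi_space \<A>) (topspace (Psi_space \<A>) - Inl ` F)"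
    unfolding openin_Psi_space by (intro exI[of _ ?\<B>]) simp
  then show ?thesis by (auto simp: closedin_def topspace_Psi_space)
qed

text \<open>The sets \<open>U\<^sup>+ \<inter> V\<^sub>1\<^sup>- \<inter> \<dots> \<inter> V\<^sub>m\<^sup>-\<close> form a basis of the Vietoris topology; it is
  spelled out here as a neighbourhood of a given point inside a given open set.\<close>

lemma vietoris_neighbourhood:
  assumes "openin (vietoris X) W" and "G \<in> W"
  obtains U \<V> where "openin X U" "G \<subseteq> U" "finite \<V>" "\<forall>V\<in>\<V>. openin X V \<and> G \<inter> V \<noteq> {}"
    "\<And>H. closedin X H \<Longrightarrow> H \<noteq> {} \<Longrightarrow> H \<subseteq> U \<Longrightarrow> \<forall>V\<in>\<V>. H \<inter> V \<noteq> {} \<Longrightarrow> H \<in> W"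
proof -
  let ?nbhd = "\<lambda>W U \<V>. openin X U \<and> G \<subseteq> U \<and> finite \<V> \<and> (\<forall>V\<in>\<V>. openin X V \<and> G \<inter> V \<noteq> {}) \<and>
    (\<forall>H. closedin X H \<and> H \<noteq> {} \<and> H \<subseteq> U \<and> (\<forall>V\<in>\<V>. H \<inter> V \<noteq> {}) \<longrightarrow> H \<in> W)"
  let ?S = "(\<lambda>U. {F. closedin X F \<and> F \<noteq> {} \<and> F \<subseteq> U}) ` {U. openin X U} \<union>
      (\<lambda>U. {F. closedin X F \<and> F \<noteq> {} \<and> F \<inter> U \<noteq> {}}) ` {U. openin X U}"
  have "generate_topology_on ?S W"
    using assms(1) by (simp add: vietoris_def openin_topology_generated_by)
  then have "\<exists>U \<V>. ?nbhd W U \<V>" using assms(2)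
  proof induction
    case Empty
    then show ?case by simp
  next
    case (Int W1 W2)
    then have "G \<in> W1" "G \<in> W2" by auto
    obtain U1 \<V>1 where 1: "?nbhd W1 U1 \<V>1" using Int.IH(1)[OF \<open>G \<in> W1\<close>] by (elim exE)
    obtain U2 \<V>2 where 2: "?nbhd W2 U2 \<V>2" using Int.IH(2)[OF \<open>G \<in> W2\<close>] by (elim exE)
    have "?nbhd (W1 \<inter> W2) (U1 \<inter> U2) (\<V>1 \<union> \<V>2)"
      using 1 2 by (simp add: openin_Int ball_Un)
    then show ?case by (intro exI)
  next
    case (UN K)
    then obtain k where k: "k \<in> K" "G \<in> k" by blast
    obtain U \<V> where U: "?nbhd k U \<V>" using UN.IH[OF k] by (elim exE)
    have "?nbhd (\<Union>K) U \<V>" using U k(1) by (meson UnionI)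
    then show ?case by (intro exI)
  next
    case (Basis W)
    then consider
      (upper) U where "openin X U" "W = {F. closedin X F \<and> F \<noteq> {} \<and> F \<subseteq> U}"
      | (lower) V where "openin X V" "W = {F. closedin X F \<and> F \<noteq> {} \<and> F \<inter> V \<noteq> {}}"
      by auto
    then show ?case
    proof cases
      case upper
      then have "?nbhd W U {}" using Basis by auto
      then show ?thesis by (intro exI)
    next
      case lower
      then have "?nbhd W (topspace X) {V}" using Basis closedin_subset[of X] by auto
      then show ?thesis by (intro exI)
    qed
  qed
  then obtain U \<V> where "?nbhd W U \<V>" by (elim exE)
  then show thesis by (intro that[of U \<V>]) simp_all
qed

lemma finite_sets_dense_in_vietoris:
  assumes \<A>: "\<forall>a\<in>\<A>. infinite a" and W: "openin (vietoris (Psi_space \<A>)) W" "G \<in> W"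
  shows "\<exists>F. finite F \<and> F \<noteq> {} \<and> Inl ` F \<in> W"
proof -
  have "G \<noteq> {}" using openin_subset[OF W(1)] W(2) by (auto simp: topspace_vietoris)
  obtain U \<V> where U: "openin (Psi_space \<A>) U" "G \<subseteq> U"
    and \<V>: "finite \<V>" "\<forall>V\<in>\<V>. openin (Psi_space \<A>) V \<and> G \<inter> V \<noteq> {}"
    and sub: "\<And>H. closedin (Psi_space \<A>) H \<Longrightarrow> H \<noteq> {} \<Longrightarrow> H \<subseteq> U \<Longrightarrow>
      \<forall>V\<in>\<V>. H \<inter> V \<noteq> {} \<Longrightarrow> H \<in> W"
    by (rule vietoris_neighbourhood[OF W]) (blast intro: that)
  \<comment> \<open>Adding \<open>U\<close> itself to the sets to be met keeps the chosen set nonempty.\<close>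
  have "\<exists>n. Inl n \<in> U \<inter> V" if "V \<in> insert U \<V>" for V
  proof (rule Psi_open_meets_naturals[OF \<A>])
    show "openin (Psi_space \<A>) (U \<inter> V)" using that U \<V> by auto
    show "U \<inter> V \<noteq> {}" using that U(2) \<V>(2) \<open>G \<noteq> {}\<close> by blast
  qed
  then obtain p where p: "\<And>V. V \<in> insert U \<V> \<Longrightarrow> Inl (p V) \<in> U \<inter> V" by metis
  let ?F = "p ` insert U \<V>"
  have "Inl ` ?F \<in> W"
  proof (rule sub)
    show "closedin (Psi_space \<A>) (Inl ` ?F)" using \<V>(1) by (intro closedin_Psi_finite) simp
    show "Inl ` ?F \<subseteq> U" using p by blast
    show "\<forall>V\<in>\<V>. Inl ` ?F \<inter> V \<noteq> {}" using p by blast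
  qed simp
  then show ?thesis using \<V>(1) by (intro exI[of _ ?F]) auto
qed

text \<open>The limit \<open>G\<close> is taken along the filter generated by \<open>T\<close>. That \<open>F k\<close> meets the open sets met
  by \<open>G\<close> holds by definition of \<open>G\<close>; that \<open>F k\<close> is eventually inside an open \<open>U \<supseteq> G\<close> is where
  convergence of all sequences is needed, since a bad choice of points from the \<open>F k\<close> must be
  caught by some point of \<open>G\<close>.\<close>

lemma finite_sets_accumulate:
  fixes F :: "nat \<Rightarrow> nat set"
  assumes pc: "pseudointersection_number =o continuum" and mad: "mad_family \<A>"
    and F: "\<And>k. F k \<noteq> {}" "\<And>k. finite (F k)"
  shows "\<exists>G\<in>topspace (vietoris (Psi_space \<A>)).
    \<forall>W. openin (vietoris (Psi_space \<A>)) W \<and> G \<in> W \<longrightarrow> infinite {k. Inl ` F k \<in> W}"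
proof -
  obtain T :: "(nat \<Rightarrow> nat) \<Rightarrow> nat set" where T: "centered (range T)"
    and conv: "\<And>s. (\<exists>n. \<forall>k\<in>T s. s k = n) \<or> (inj_on s (T s) \<and> (\<exists>a\<in>\<A>. s ` T s \<subseteq> a))"
    using selector_tower[OF pc mad] by blast
  \<comment> \<open>Centeredness only speaks of nonempty finite subcollections, hence \<open>S \<noteq> {}\<close>.\<close>
  define large where
    "large K \<longleftrightarrow> (\<exists>S. finite S \<and> S \<noteq> {} \<and> finite (\<Inter>(T ` S) - K))" for K
  have large_mono: "large L" if "large K" "K \<subseteq> L" for K L
    using that unfolding large_def by (meson Diff_mono finite_subset order_refl)
  have large_Int: "large (K \<inter> L)" if KL: "large K" "large L" for K L
  proof -
    obtain S S' where S: "finite S" "S \<noteq> {}" "finite (\<Inter>(T ` S) - K)"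
      and S': "finite S'" "finite (\<Inter>(T ` S') - L)"
      using KL unfolding large_def by blast
    have "finite (\<Inter>(T ` (S \<union> S')) - K \<inter> L)"
      by (rule finite_subset[of _ "(\<Inter>(T ` S) - K) \<union> (\<Inter>(T ` S') - L)"]) (use S S' in auto)
    then show ?thesis
      unfolding large_def using S S' by (intro exI[of _ "S \<union> S'"]) auto
  qed
  have large_INT: "large (K \<inter> (\<Inter>i\<in>\<V>. L i))"
    if "finite \<V>" "large K" "\<And>i. i \<in> \<V> \<Longrightarrow> large (L i)"
    for \<V> :: "(nat + nat set) set set" and K L
    using that
  proof (induction)
    case (insert i \<V>)
    have "large (L i \<inter> (K \<inter> (\<Inter>i\<in>\<V>. L i)))" by (rule large_Int) (use insert in auto)
    then show ?case by (rule large_mono) auto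
  qed simp
  have large_infinite: "infinite K" if large: "large K" for K
  proof -
    obtain S where S: "finite S" "S \<noteq> {}" "finite (\<Inter>(T ` S) - K)"
      using large unfolding large_def by blast
    have "infinite (\<Inter>(T ` S))"
      using T S(1,2) unfolding centered_def by (intro T[unfolded centered_def, rule_format]) auto
    then show ?thesis using S(3) by (metis Diff_infinite_finite)
  qed
  define meets where "meets V = {k. Inl ` F k \<inter> V \<noteq> {}}" for V :: "(nat + nat set) set"
  define G where "G = {x \<in> topspace (Psi_space \<A>).
    \<forall>V. openin (Psi_space \<A>) V \<and> x \<in> V \<longrightarrow> large (meets V)}"
  have selector_limit: "\<exists>x\<in>G. \<forall>V. openin (Psi_space \<A>) V \<and> x \<in> V \<longrightarrow> large {k. Inl (s k) \<in> V}"
    if s: "\<And>k. s k \<in> F k" for s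
  proof -
    have "\<exists>x\<in>topspace (Psi_space \<A>).
        \<forall>V. openin (Psi_space \<A>) V \<and> x \<in> V \<longrightarrow> finite (T s - {k. Inl (s k) \<in> V})"
      using conv[of s]
    proof (elim disjE exE conjE bexE)
      fix n assume const: "\<forall>k\<in>T s. s k = n"
      have "finite (T s - {k. Inl (s k) \<in> V})" if "Inl n \<in> V" for V :: "(nat + nat set) set"
        by (rule finite_subset[of _ "{}"]) (use that const in auto)
      then show ?thesis by (intro bexI[of _ "Inl n"]) (auto simp: topspace_Psi_space)
    next
      fix a assume a: "inj_on s (T s)" "a \<in> \<A>" "s ` T s \<subseteq> a"
      have "finite (T s - {k. Inl (s k) \<in> V})" if V: "openin (Psi_space \<A>) V" "Inr a \<in> V" for V
      proof (rule finite_imageD)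
        show "finite (s ` (T s - {k. Inl (s k) \<in> V}))"
          by (rule finite_subset[OF _ Psi_open_almost_contains[OF V]]) (use a(3) in auto)
        show "inj_on s (T s - {k. Inl (s k) \<in> V})"
          using a(1) inj_on_subset by blast
      qed
      then show ?thesis using a(2) by (intro bexI[of _ "Inr a"]) (auto simp: topspace_Psi_space)
    qed
    then obtain x where x: "x \<in> topspace (Psi_space \<A>)"
      and fin: "\<And>V. openin (Psi_space \<A>) V \<Longrightarrow> x \<in> V \<Longrightarrow> finite (T s - {k. Inl (s k) \<in> V})"
      by blast
    have lim: "large {k. Inl (s k) \<in> V}" if "openin (Psi_space \<A>) V" "x \<in> V" for V
      using fin[OF that] unfolding large_def by (intro exI[of _ "{s}"]) simp
    have "large (meets V)" if "openin (Psi_space \<A>) V" "x \<in> V" for V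
      by (rule large_mono[OF lim[OF that]]) (use s in \<open>auto simp: meets_def\<close>)
    then have "x \<in> G" using x by (simp add: G_def)
    then show ?thesis using lim by blast
  qed
  have G_closed: "closedin (Psi_space \<A>) G"
    unfolding closedin_def
  proof
    show "G \<subseteq> topspace (Psi_space \<A>)" by (auto simp: G_def)
    have "\<exists>V. openin (Psi_space \<A>) V \<and> x \<in> V \<and> V \<subseteq> topspace (Psi_space \<A>) - G"
      if "x \<in> topspace (Psi_space \<A>) - G" for x
    proof -
      have "\<not> (\<forall>V. openin (Psi_space \<A>) V \<and> x \<in> V \<longrightarrow> large (meets V))"
        using that by (simp add: G_def)
      then obtain V where V: "openin (Psi_space \<A>) V" "x \<in> V" "\<not> large (meets V)" by meson
      then have "y \<notin> G" if "y \<in> V" for y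
        using that by (auto simp only: G_def mem_Collect_eq)
      then have "V \<inter> G = {}" by blast
      then show ?thesis using V openin_subset[OF V(1)] by blast
    qed
    then show "openin (Psi_space \<A>) (topspace (Psi_space \<A>) - G)"
      using openin_subopen by metis
  qed
  have "\<exists>s. \<forall>k. s k \<in> F k" using F(1) by (intro choice) auto
  then have "G \<noteq> {}" using selector_limit by blast
  have upper: "large {k. Inl ` F k \<subseteq> U}" if U: "openin (Psi_space \<A>) U" "G \<subseteq> U" for U
  proof -
    \<comment> \<open>The worst selector: it leaves \<open>U\<close> whenever \<open>F k\<close> does.\<close>
    have "\<forall>k. \<exists>n. n \<in> F k \<and> (Inl n \<in> U \<longrightarrow> Inl ` F k \<subseteq> U)"
      using F(1) by blast
    then obtain s where s: "\<And>k. s k \<in> F k" "\<And>k. Inl (s k) \<in> U \<Longrightarrow> Inl ` F k \<subseteq> U"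
      by metis
    then have "large {k. Inl (s k) \<in> U}"
      using selector_limit[of s] U by blast
    then show ?thesis by (rule large_mono) (use s(2) in blast)
  qed
  have "infinite {k. Inl ` F k \<in> W}"
    if W: "openin (vietoris (Psi_space \<A>)) W" "G \<in> W" for W
  proof -
    obtain U \<V> where U: "openin (Psi_space \<A>) U" "G \<subseteq> U"
      and \<V>: "finite \<V>" "\<forall>V\<in>\<V>. openin (Psi_space \<A>) V \<and> G \<inter> V \<noteq> {}"
      and sub: "\<And>H. closedin (Psi_space \<A>) H \<Longrightarrow> H \<noteq> {} \<Longrightarrow> H \<subseteq> U \<Longrightarrow>
        \<forall>V\<in>\<V>. H \<inter> V \<noteq> {} \<Longrightarrow> H \<in> W"
      by (rule vietoris_neighbourhood[OF W]) (blast intro: that)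
    have "large (meets V)" if "V \<in> \<V>" for V
      using \<V>(2) that by (fastforce simp only: G_def mem_Collect_eq)
    then have "large ({k. Inl ` F k \<subseteq> U} \<inter> (\<Inter>V\<in>\<V>. meets V))"
      by (intro large_INT \<V>(1) upper[OF U])
    then have "large {k. Inl ` F k \<in> W}"
      
    proof (rule large_mono, intro subsetI CollectI)
      fix k assume k: "k \<in> {k. Inl ` F k \<subseteq> U} \<inter> (\<Inter>V\<in>\<V>. meets V)"
      show "Inl ` F k \<in> W"
        by (rule sub[OF closedin_Psi_finite[OF F(2)]]) (use F(1) k in \<open>auto simp: meets_def\<close>)
    qed
    then show ?thesis by (rule large_infinite)
  qed
  then show ?thesis
    using G_closed \<open>G \<noteq> {}\<close> by (auto simp: topspace_vietoris)
qed

theorem mad_family_pseudocompact: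
  assumes pc: "pseudointersection_number =o continuum" and mad: "mad_family \<A>"
  shows "pseudocompact_family \<A>"
  unfolding pseudocompact_family_def pseudocompact_space_def
proof (intro allI impI)
  let ?X = "vietoris (Psi_space \<A>)"
  fix f assume f: "continuous_map ?X euclideanreal f"
  have inf: "\<forall>a\<in>\<A>. infinite a"
    using mad by (simp add: mad_family_def almost_disjoint_family_def)
  have preimage: "openin ?X {H \<in> topspace ?X. f H \<in> U}" if "open U" for U
    using openin_continuous_map_preimage[OF f] that by simp
  show "bounded (f ` topspace ?X)"
  proof (rule ccontr)
    assume "\<not> bounded (f ` topspace ?X)"
    then have unbounded: "\<exists>H\<in>topspace ?X. \<bar>f H\<bar> > real k" for k :: nat
      unfolding bounded_iff by (metis image_iff not_le real_norm_def)
    have "\<exists>F. finite F \<and> F \<noteq> {} \<and> \<bar>f (Inl ` F)\<bar> > real k" for k :: nat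
    proof -
      have "open {x :: real. \<bar>x\<bar> > real k}" by (intro open_Collect_less continuous_intros)
      from preimage[OF this] unbounded[of k] show ?thesis
        using finite_sets_dense_in_vietoris[OF inf] by blast
    qed
    then obtain F where F: "\<And>k::nat. finite (F k) \<and> F k \<noteq> {} \<and> \<bar>f (Inl ` F k)\<bar> > real k"
      by metis
    obtain G where G: "G \<in> topspace ?X"
      and acc: "\<And>W. openin ?X W \<Longrightarrow> G \<in> W \<Longrightarrow> infinite {k. Inl ` F k \<in> W}"
      using finite_sets_accumulate[OF pc mad, of F] F by blast
    have "open {x :: real. \<bar>x\<bar> < \<bar>f G\<bar> + 1}" by (intro open_Collect_less continuous_intros)
    from acc[OF preimage[OF this]] G
    have "infinite {k. Inl ` F k \<in> topspace ?X \<and> \<bar>f (Inl ` F k)\<bar> < \<bar>f G\<bar> + 1}" by simp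
    moreover have "{k. Inl ` F k \<in> topspace ?X \<and> \<bar>f (Inl ` F k)\<bar> < \<bar>f G\<bar> + 1} \<subseteq> {..nat \<lceil>\<bar>f G\<bar> + 1\<rceil>}"
    proof
      fix k assume "k \<in> {k. Inl ` F k \<in> topspace ?X \<and> \<bar>f (Inl ` F k)\<bar> < \<bar>f G\<bar> + 1}"
      then have "real k < \<bar>f G\<bar> + 1" using F[of k] by simp
      then show "k \<in> {..nat \<lceil>\<bar>f G\<bar> + 1\<rceil>}" by (simp, linarith)
    qed
    ultimately show False using finite_subset by blast
  qed
qed

section \<open>Completely separable families of partial selectors\<close>

definition partial_selector :: "(nat \<Rightarrow> nat set) \<Rightarrow> nat set \<Rightarrow> bool" where
  "partial_selector C a \<longleftrightarrow> (\<forall>n. card (a \<inter> C n) \<le> 1)"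

text \<open>As the \<open>C n\<close> are finite, an infinite set either has infinitely many points outside all of
  them or meets infinitely many of them.\<close>

lemma infinite_partial_selector:
  assumes C: "fin_sequence C" and P: "infinite P"
  shows "\<exists>Q\<subseteq>P. infinite Q \<and> partial_selector C Q"
proof (cases "finite (P - \<Union>(range C))")
  case False
  have "(P - \<Union>(range C)) \<inter> C n = {}" for n by blast
  then show ?thesis
    using False by (intro exI[of _ "P - \<Union>(range C)"]) (auto simp: partial_selector_def)
next
  case True
  let ?J = "{n. P \<inter> C n \<noteq> {}}"
  have disj: "x \<in> C n \<Longrightarrow> x \<in> C m \<Longrightarrow> n = m" for x n m
    using C unfolding fin_sequence_def by blast
  have "infinite ?J"
  proof
    assume "finite ?J"
    then have "finite (\<Union>n\<in>?J. C n)" using C by (auto simp: fin_sequence_def)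
    then have "finite ((P - \<Union>(range C)) \<union> (\<Union>n\<in>?J. C n))" using True by blast
    then have "finite P" by (rule finite_subset[rotated]) blast
    then show False using P by simp
  qed
  have "\<exists>p. \<forall>n\<in>?J. p n \<in> P \<inter> C n" by (rule bchoice) blast
  then obtain p where p: "\<And>n. n \<in> ?J \<Longrightarrow> p n \<in> P" "\<And>n. n \<in> ?J \<Longrightarrow> p n \<in> C n" by blast
  have "inj_on p ?J" by (rule inj_onI) (metis p(2) disj)
  then have "infinite (p ` ?J)" using \<open>infinite ?J\<close> finite_imageD by blast
  moreover have "partial_selector C (p ` ?J)"
    unfolding partial_selector_def
  proof
    fix n
    have "p ` ?J \<inter> C n \<subseteq> {p n}" using disj[OF p(2)] by blast
    then have "card (p ` ?J \<inter> C n) \<le> card {p n}" by (rule card_mono[rotated]) simp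
    then show "card (p ` ?J \<inter> C n) \<le> 1" by simp
  qed
  moreover have "p ` ?J \<subseteq> P" using p(1) by blast
  ultimately show ?thesis by (intro exI[of _ "p ` ?J"]) simp
qed

lemma ad_ideal_downward: "Y \<in> ad_ideal \<A> \<Longrightarrow> X \<subseteq> Y \<Longrightarrow> X \<in> ad_ideal \<A>"
  unfolding ad_ideal_def almost_subset_def by (blast intro: finite_subset[OF Diff_mono])

lemma centered_complements:
  assumes "X \<in> ad_positive \<A>"
  shows "centered ((\<lambda>a. X - a) ` \<A>)"
  unfolding centered_def
proof (intro allI impI)
  fix \<F> assume \<F>: "finite \<F> \<and> \<F> \<noteq> {} \<and> \<F> \<subseteq> (\<lambda>a. X - a) ` \<A>"
  then obtain \<B> where \<B>: "finite \<B>" "\<B> \<subseteq> \<A>" "\<F> = (\<lambda>a. X - a) ` \<B>"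
    by (meson finite_subset_image)
  have "\<B> \<noteq> {}" using \<F> \<B>(3) by blast
  then have "\<Inter>\<F> = X - \<Union>\<B>" using \<B>(3) by blast
  moreover have "infinite (X - \<Union>\<B>)"
    using assms \<B> by (auto simp: ad_positive_def ad_ideal_def almost_subset_def)
  ultimately show "infinite (\<Inter>\<F>)" by simp
qed

text \<open>This is one step of the recursion. Positivity of \<open>X\<close> says precisely that the complements
  \<open>X - a\<close> are centered; a pseudointersection of them is almost disjoint from all of \<open>\<A>\<close>, and it
  stays so when thinned out to a partial selector.\<close>

lemma almost_disjoint_subset_exists:
  assumes pc: "pseudointersection_number =o continuum"
    and C: "fin_sequence C" and X: "X \<in> ad_positive \<A>" and card: "|\<A>| <o continuum"
  shows "\<exists>y\<subseteq>X. infinite y \<and> partial_selector C y \<and> (\<forall>a\<in>\<A>. finite (y \<inter> a))"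
proof -
  have "\<exists>P\<subseteq>X. infinite P \<and> (\<forall>a\<in>\<A>. finite (P \<inter> a))"
  proof (cases "\<A> = {}")
    case True
    have "infinite X" using X by (auto simp: ad_positive_def ad_ideal_def almost_subset_def)
    then show ?thesis using True by blast
  next
    case False
    have "|(\<lambda>a. X - a) ` \<A>| <o continuum"
      using card card_of_image ordLeq_ordLess_trans by blast
    then obtain P where P: "infinite P" "\<And>a. a \<in> \<A> \<Longrightarrow> finite (P - (X - a))"
      using pseudointersection_exists[OF pc centered_complements[OF X]]
      by (auto simp: almost_subset_def)
    obtain a where "a \<in> \<A>" using False by blast
    have "finite (P - X)" by (rule finite_subset[OF _ P(2)[OF \<open>a \<in> \<A>\<close>]]) blast
    then have "infinite (P - (P - X))" using P(1) by (rule Diff_infinite_finite)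
    then have "infinite (P \<inter> X)" by (simp add: Diff_Diff_Int)
    moreover have "finite (P \<inter> X \<inter> b)" if "b \<in> \<A>" for b
      by (rule finite_subset[OF _ P(2)[OF that]]) blast
    ultimately show ?thesis by blast
  qed
  then obtain P where P: "P \<subseteq> X" "infinite P" "\<And>a. a \<in> \<A> \<Longrightarrow> finite (P \<inter> a)" by blast
  obtain y where y: "y \<subseteq> P" "infinite y" "partial_selector C y"
    using infinite_partial_selector[OF C P(2)] by blast
  have "finite (y \<inter> a)" if "a \<in> \<A>" for a
    by (rule finite_subset[OF _ P(3)[OF that]]) (use y(1) in blast)
  then show ?thesis using y P(1) by blast
qed

text \<open>If \<open>k\<close> partial selectors covered all but \<open>r\<close> points of the union, then each \<open>C n\<close> with
  \<open>n \<in> I\<close> would have at most \<open>k + r\<close> points, which fails for large \<open>n\<close>.\<close>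

lemma union_of_large_blocks_positive:
  assumes C: "fin_sequence C" and large: "\<And>n. card (C n) > n"
    and \<A>: "\<forall>a\<in>\<A>. partial_selector C a" and I: "infinite I"
  shows "\<Union>(C ` I) \<in> ad_positive \<A>"
proof (rule ccontr)
  assume "\<Union>(C ` I) \<notin> ad_positive \<A>"
  then obtain \<B> where \<B>: "finite \<B>" "\<B> \<subseteq> \<A>" "finite (\<Union>(C ` I) - \<Union>\<B>)"
    by (auto simp: ad_positive_def ad_ideal_def almost_subset_def)
  let ?R = "\<Union>(C ` I) - \<Union>\<B>"
  obtain n where n: "n \<in> I" "n > card \<B> + card ?R"
    using I by (meson infinite_nat_iff_unbounded)
  have "C n \<subseteq> (\<Union>a\<in>\<B>. a \<inter> C n) \<union> ?R" using n(1) by blast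
  moreover have "finite ((\<Union>a\<in>\<B>. a \<inter> C n) \<union> ?R)"
    using \<B> C by (auto simp: fin_sequence_def)
  ultimately have "card (C n) \<le> card ((\<Union>a\<in>\<B>. a \<inter> C n) \<union> ?R)" by (rule card_mono[rotated])
  also have "\<dots> \<le> card (\<Union>a\<in>\<B>. a \<inter> C n) + card ?R" by (rule card_Un_le)
  finally have bound: "card (C n) \<le> card (\<Union>a\<in>\<B>. a \<inter> C n) + card ?R" .
  have "card (\<Union>a\<in>\<B>. a \<inter> C n) \<le> (\<Sum>a\<in>\<B>. card (a \<inter> C n))" by (rule card_UN_le[OF \<B>(1)])
  also have "\<dots> \<le> (\<Sum>a\<in>\<B>. 1)"
    using \<A> \<B>(2) by (intro sum_mono) (auto simp: partial_selector_def)
  finally have "card (\<Union>a\<in>\<B>. a \<inter> C n) \<le> card \<B>" by simp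
  then show False using bound n(2) large[of n] by linarith
qed

text \<open>Once every positive set contains a member, the family is automatically infinite and maximal:
  the complement of the union of a finite family would be positive, but a member inside it would
  be empty; and an infinite set almost disjoint from the whole family is positive, so it
  contains a member and meets that member in an infinite set.\<close>

lemma completely_separableI:
  assumes ad: "\<forall>a\<in>\<A>. infinite a" "\<forall>a\<in>\<A>. \<forall>b\<in>\<A>. a \<noteq> b \<longrightarrow> finite (a \<inter> b)"
    and pos: "UNIV \<in> ad_positive \<A>" "\<forall>X\<in>ad_positive \<A>. \<exists>a\<in>\<A>. a \<subseteq> X"
  shows "completely_separable \<A>"
proof -
  have "infinite \<A>"
  proof
    assume fin: "finite \<A>"
    have "- \<Union>\<A> \<in> ad_positive \<A>"
    proof (rule ccontr)
      assume "- \<Union>\<A> \<notin> ad_positive \<A>"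
      then obtain \<B> where \<B>: "\<B> \<subseteq> \<A>" "finite (- \<Union>\<A> - \<Union>\<B>)"
        by (auto simp: ad_positive_def ad_ideal_def almost_subset_def)
      have "- \<Union>\<A> - \<Union>\<B> = - \<Union>\<A>"
        unfolding Diff_eq by (rule inf_absorb1) (simp add: Union_mono[OF \<B>(1)])
      then have "finite (UNIV - \<Union>\<A>)"
        using \<B>(2) by (simp add: Compl_eq_Diff_UNIV)
      then have "UNIV \<in> ad_ideal \<A>"
        unfolding ad_ideal_def almost_subset_def
        using fin by (intro CollectI exI[of _ \<A>]) simp
      then show False using pos(1) by (simp add: ad_positive_def)
    qed
    then obtain a where "a \<in> \<A>" "a \<subseteq> - \<Union>\<A>" using pos(2) by blast
    then have "a = {}" by blast
    then show False using ad(1) \<open>a \<in> \<A>\<close> by auto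
  qed
  then have adf: "almost_disjoint_family \<A>"
    using ad by (simp add: almost_disjoint_family_def)
  have "\<not> \<A> \<subset> \<B>" if \<B>: "almost_disjoint_family \<B>" for \<B>
  proof
    assume sub: "\<A> \<subset> \<B>"
    then obtain X where X: "X \<in> \<B>" "X \<notin> \<A>" by blast
    have X_inf: "infinite X" using \<B> X(1) by (simp add: almost_disjoint_family_def)
    have X_ad: "finite (X \<inter> a)" if "a \<in> \<A>" for a
    proof -
      have "a \<in> \<B>" "X \<noteq> a" using that sub X(2) by auto
      then show ?thesis using \<B> X(1) by (simp add: almost_disjoint_family_def)
    qed
    have "X \<in> ad_positive \<A>"
    proof (rule ccontr)
      assume "X \<notin> ad_positive \<A>"
      then obtain \<C> where \<C>: "finite \<C>" "\<C> \<subseteq> \<A>" "finite (X - \<Union>\<C>)"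
        by (auto simp: ad_positive_def ad_ideal_def almost_subset_def)
      have "finite (\<Union>a\<in>\<C>. X \<inter> a)"
        by (rule finite_UN_I[OF \<C>(1)]) (use \<C>(2) X_ad in blast)
      then have "finite ((X - \<Union>\<C>) \<union> (\<Union>a\<in>\<C>. X \<inter> a))" using \<C>(3) by blast
      then have "finite X" by (rule finite_subset[rotated]) blast
      then show False using X_inf by simp
    qed
    then obtain a where "a \<in> \<A>" "a \<subseteq> X" using pos(2) by blast
    then show False using X_ad[of a] ad(1) by (simp add: Int_absorb1)
  qed
  then show ?thesis
    using adf pos(2) by (auto simp: completely_separable_def mad_family_def)
qed

lemma completely_separable_selectors:
  assumes pc: "pseudointersection_number =o continuum"
    and C: "fin_sequence C" and large: "\<And>n. card (C n) > n"
  shows "\<exists>\<A>. completely_separable \<A> \<and> (\<forall>a\<in>\<A>. partial_selector C a)"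
proof -
  let ?r = "|UNIV :: nat set set|"
  \<comment> \<open>The empty set records the stages that contribute no member.\<close>
  let ?P = "\<lambda>T X y. if X \<in> ad_positive (T ` underS ?r X)
    then y \<subseteq> X \<and> infinite y \<and> partial_selector C y \<and> (\<forall>a\<in>T ` underS ?r X. finite (y \<inter> a))
    else y = {}"
  have r: "?r \<le>o continuum"
    using continuum_ordIso_card_of ordIso_symmetric ordIso_imp_ordLeq by blast
  have "\<exists>T. \<forall>X. ?P T X (T X)"
  proof (rule dependent_wf_choice[OF wf_card_of[of UNIV]], goal_cases)
    case (1 f g X y)
    then have "f ` underS ?r X = g ` underS ?r X"
      by (intro image_cong) (auto simp: underS_def)
    then show ?case by simp
  next
    case (2 X T)
    show ?case
    proof (cases "X \<in> ad_positive (T ` underS ?r X)")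
      case True
      then show ?thesis
        using almost_disjoint_subset_exists[OF pc C True initial_segment_less_continuum[OF r]]
        by simp
    qed simp
  qed
  then obtain T where T: "\<And>X. ?P T X (T X)" by blast
  define \<A> where "\<A> = range T - {{}}"
  have member: "infinite (T X) \<and> partial_selector C (T X)" if "T X \<noteq> {}" for X
    using T[of X] that by (simp split: if_splits)
  have sel: "\<forall>a\<in>\<A>. partial_selector C a" and inf: "\<forall>a\<in>\<A>. infinite a"
    using member unfolding \<A>_def by auto
  have below: "finite (T X \<inter> T Z)" if "(Z, X) \<in> ?r" "Z \<noteq> X" for X Z
    using T[of X] that by (auto simp: underS_def split: if_splits)
  have tot: "(X, Z) \<in> ?r \<or> (Z, X) \<in> ?r" if "X \<noteq> Z" for X Z
    using card_of_Well_order[of "UNIV :: nat set set"] that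
    unfolding well_order_on_def linear_order_on_def total_on_def by (auto simp: Field_card_of)
  have ad: "\<forall>a\<in>\<A>. \<forall>b\<in>\<A>. a \<noteq> b \<longrightarrow> finite (a \<inter> b)"
  proof (intro ballI impI)
    fix a b assume ab: "a \<in> \<A>" "b \<in> \<A>" "a \<noteq> b"
    then obtain X Z where XZ: "a = T X" "b = T Z" "X \<noteq> Z" unfolding \<A>_def by blast
    from tot[OF XZ(3)] show "finite (a \<inter> b)"
      using below[of X Z] below[of Z X] XZ by (auto simp: Int_commute)
  qed
  have pos: "\<exists>a\<in>\<A>. a \<subseteq> X" if X: "X \<in> ad_positive \<A>" for X
  proof -
    have "X \<in> ad_positive (T ` underS ?r X)"
    proof (rule ccontr)
      assume "X \<notin> ad_positive (T ` underS ?r X)"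
      then obtain \<B> where "finite \<B>" "\<B> \<subseteq> T ` underS ?r X" "X \<subseteq>\<^sup>* \<Union>\<B>"
        by (auto simp: ad_positive_def ad_ideal_def)
      then have \<B>: "finite \<B>" "\<B> \<subseteq> range T" "X \<subseteq>\<^sup>* \<Union>\<B>" by auto
      have "\<Union>(\<B> - {{}}) = \<Union>\<B>" by blast
      then have "X \<in> ad_ideal \<A>"
        using \<B> unfolding ad_ideal_def \<A>_def
        by (intro CollectI exI[of _ "\<B> - {{}}"]) auto
      then show False using X by (simp add: ad_positive_def)
    qed
    then have "T X \<subseteq> X" "infinite (T X)" using T[of X] by auto
    then show ?thesis unfolding \<A>_def by (intro bexI[of _ "T X"]) auto
  qed
  have "UNIV \<in> ad_positive \<A>"
  proof (rule ccontr)
    assume "UNIV \<notin> ad_positive \<A>"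
    then have "UNIV \<in> ad_ideal \<A>" by (simp add: ad_positive_def)
    then have "\<Union>(range C) \<in> ad_ideal \<A>" by (rule ad_ideal_downward) simp
    then show False
      using union_of_large_blocks_positive[OF C large sel, of UNIV] by (simp add: ad_positive_def)
  qed
  then have "completely_separable \<A>"
    using inf ad pos by (intro completely_separableI) auto
  then show ?thesis using sel by blast
qed

text \<open>Already two members of \<open>\<A>\<close> witness the failure for a given \<open>I\<close>: their traces on the index
  set are infinite, because the \<open>C n\<close> are finite, and lie in disjoint halves of \<open>I\<close>.\<close>

lemma not_fin_intersecting:
  assumes C: "fin_sequence C" and large: "\<And>n. card (C n) > n"
    and \<A>: "completely_separable \<A>" and sel: "\<forall>a\<in>\<A>. partial_selector C a"
  shows "\<not> fin_intersecting \<A>"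
proof
  assume "fin_intersecting \<A>"
  then obtain I where I: "infinite I" and
    cent: "centered ((\<lambda>a. {n \<in> I. a \<inter> C n \<noteq> {}}) ` \<A> - {J. J \<subseteq> I \<and> finite J})"
    using C unfolding fin_intersecting_def by blast
  let ?hit = "\<lambda>a. {n \<in> I. a \<inter> C n \<noteq> {}}"
  have member: "\<exists>a\<in>\<A>. infinite (?hit a) \<and> ?hit a \<subseteq> J" if J: "J \<subseteq> I" "infinite J" for J
  proof -
    obtain a where a: "a \<in> \<A>" "a \<subseteq> \<Union>(C ` J)"
      using \<A> union_of_large_blocks_positive[OF C large sel J(2)]
      unfolding completely_separable_def by blast
    have "infinite a"
      using \<A> a(1) by (auto simp: completely_separable_def mad_family_def almost_disjoint_family_def)
    moreover have "a \<subseteq> (\<Union>n\<in>?hit a. C n)" using a(2) J(1) by blast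
    ultimately have "infinite (?hit a)"
      using C by (meson fin_sequence_def finite_UN_I finite_subset)
    moreover have "?hit a \<subseteq> J"
    proof
      fix n assume "n \<in> ?hit a"
      then obtain x m where "x \<in> C n" "x \<in> C m" "m \<in> J" using a(2) by blast
      moreover have "C n \<inter> C m = {}" if "n \<noteq> m" using C that by (simp add: fin_sequence_def)
      ultimately show "n \<in> J" by blast
    qed
    ultimately show ?thesis using a(1) by blast
  qed
  obtain J K where JK: "J \<subseteq> I" "K \<subseteq> I" "infinite J" "infinite K" "J \<inter> K = {}"
    using infinite_split[OF I] by blast
  obtain a where a: "a \<in> \<A>" "infinite (?hit a)" "?hit a \<subseteq> J" using member JK by blast
  obtain b where b: "b \<in> \<A>" "infinite (?hit b)" "?hit b \<subseteq> K" using member JK by blast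
  have "infinite (\<Inter>{?hit a, ?hit b})"
    by (rule cent[unfolded centered_def, rule_format]) (use a b in auto)
  moreover have "\<Inter>{?hit a, ?hit b} = {}" using a(3) b(3) JK(5) by auto
  ultimately show False by simp
qed

lemma fin_sequence_with_large_blocks: "\<exists>C. fin_sequence C \<and> (\<forall>n. card (C n) > n)"
proof -
  let ?C = "\<lambda>n. (\<lambda>i. prod_encode (n, i)) ` {..n}"
  have "card (?C n) = Suc n" for n by (subst card_image) (auto simp: inj_on_def)
  moreover have "fin_sequence ?C" by (auto simp: fin_sequence_def)
  ultimately show ?thesis by (intro exI[of _ ?C]) auto
qed

theorem proposition26:
  assumes "pseudointersection_number =o continuum"
  shows "\<exists>\<A>. mad_family \<A> \<and> completely_separable \<A> \<and> pseudocompact_family \<A> \<and>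
           \<not> fin_intersecting \<A>"
proof -
  obtain C where C: "fin_sequence C" "\<And>n. card (C n) > n"
    using fin_sequence_with_large_blocks by blast
  obtain \<A> where \<A>: "completely_separable \<A>" "\<forall>a\<in>\<A>. partial_selector C a"
    using completely_separable_selectors[OF assms C] by blast
  have mad: "mad_family \<A>" using \<A>(1) by (simp add: completely_separable_def)
  show ?thesis
    using mad \<A>(1) mad_family_pseudocompact[OF assms mad] not_fin_intersecting[OF C \<A>] by blast
qed

end
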